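(* In Zermelo-Fraenkel set theory without the Axiom of Choice, the Principle of Dependent Choices (DC) implies the gauge ordering principle (BBg-P$j$), for each $j\in\{1,2,3,4,5,6\}$.
   Context: (DC): for every nonempty set $M$, every relation $\mathcal{R}$ on $M$ such that $\mathcal{R}(x):=\{y\in M: x\mathcal{R}y\}$ is nonempty for each $x\in M$, and every $a\in M$, there is a sequence $(x_n;\,n\ge0)$ in $M$ with $x_0=a$ and $x_{n+1}\in\mathcal{R}(x_n)$ for all $n\ge0$. A quasi-order is a reflexive and transitive relation. A quasi-ordered set $(M,\le)$ ($M$ nonempty) is sequentially inductive if each ascending sequence in $M$ ($x_n\le x_m$ for $n\le m$) has an upper bound modulo $\le$. A function $\varphi:M\to\mathbb{R}\cup\{-\infty,\infty\}$ is $(\le)$-decreasing if $x_1\le x_2$ implies $\varphi(x_1)\ge\varphi(x_2)$. A point $z\in M$ is $(\le,\varphi)$-maximal if $z\le w\in M$ implies $\varphi(z)=\varphi(w)$. For a sequence $\Phi=(\varphi_i;\,i\ge0)$ of functions $M\to\mathbb{R}\cup\{-\infty,\infty\}$, $\max(M;\le;\Phi)$ is the set of points that are $(\le,\varphi_i)$-maximal for every $i\ge 0$. Subclasses of functions $\varphi:M\to\mathbb{R}\cup\{-\infty,\infty\}$: (P1) $\varphi(M)\subseteq\mathbb{R}$ and $\varphi$ is bounded ($-\infty<\inf\varphi(M)\le\sup\varphi(M)<\infty$); (P2) the general case (no restriction; the values $\pm\infty$ are allowed); (P3) $\varphi(M)\subseteq\mathbb{R}\cup\{\infty\}$ and $\inf\varphi(M)>-\infty$;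 (P4) $\varphi(M)\subseteq\mathbb{R}\cup\{\infty\}$ and $\inf\varphi(M)\ge 0$; (P5) $\varphi(M)\subseteq\mathbb{R}$ and $\inf\varphi(M)>-\infty$; (P6) $\varphi(M)\subseteq\mathbb{R}$ and $\inf\varphi(M)\ge 0$. (BBg-P$j$): for every nonempty set $M$, every quasi-order $\le$ on $M$ such that $(M,\le)$ is sequentially inductive, and every sequence $\Phi=(\varphi_i;\,i\ge0)$ of $(\le)$-decreasing functions $M\to\mathbb{R}\cup\{-\infty,\infty\}$ all belonging to (P$j$), the set $\max(M;\le;\Phi)$ is $(\le)$-cofinal in $M$ (for each $u\in M$ there is $v\in\max(M;\le;\Phi)$ with $u\le v$) and $(\le)$-invariant in $M$ ($u\in\max(M;\le;\Phi)$ and $u\le v\in M$ imply $v\in\max(M;\le;\Phi)$). *)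

theory Defs
  imports Main
begin

text \<open>
  Isabelle/HOL has a global choice operator, so a theorem of Zermelo-Fraenkel set theory
  \<^emph>\<open>without\<close> choice cannot be stated about HOL sets: DC would simply be true.  Instead, ``ZF
  proves \<open>\<psi>\<close>'' is rendered as ``\<open>\<psi>\<close> holds in every model of ZF'', a model being an arbitrary
  type with a binary relation that satisfies the first-order axioms.  All notions below are
  formulas of the language of set theory, interpreted in such a structure: every quantifier
  ranges over the elements of the structure, never over HOL sets or functions.
\<close>

section \<open>Models of ZF\<close>

datatype fm = Mem nat nat | Equal nat nat | Neg fm | Conj fm fm | Exists nat fm

primrec sat :: "('a \<Rightarrow> 'a \<Rightarrow> bool) \<Rightarrow> (nat \<Rightarrow> 'a) \<Rightarrow> fm \<Rightarrow> bool" where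
  "sat E e (Mem i j) \<longleftrightarrow> E (e i) (e j)"
| "sat E e (Equal i j) \<longleftrightarrow> e i = e j"
| "sat E e (Neg p) \<longleftrightarrow> \<not> sat E e p"
| "sat E e (Conj p q) \<longleftrightarrow> sat E e p \<and> sat E e q"
| "sat E e (Exists i p) \<longleftrightarrow> (\<exists>x. sat E (e(i := x)) p)"

context
  fixes mem :: "'a \<Rightarrow> 'a \<Rightarrow> bool"  (infix "\<^bold>\<in>" 50)
begin

definition is_subset :: "'a \<Rightarrow> 'a \<Rightarrow> bool"  (infix "\<^bold>\<subseteq>" 50) where
  "x \<^bold>\<subseteq> y \<longleftrightarrow> (\<forall>z. z \<^bold>\<in> x \<longrightarrow> z \<^bold>\<in> y)"

definition is_empty :: "'a \<Rightarrow> bool" where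
  "is_empty x \<longleftrightarrow> (\<forall>z. \<not> z \<^bold>\<in> x)"

text \<open>\<open>y = x \<union> {x}\<close>\<close>

definition is_succ :: "'a \<Rightarrow> 'a \<Rightarrow> bool" where
  "is_succ x y \<longleftrightarrow> (\<forall>z. z \<^bold>\<in> y \<longleftrightarrow> z \<^bold>\<in> x \<or> z = x)"

definition is_inductive :: "'a \<Rightarrow> bool" where
  "is_inductive w \<longleftrightarrow>
     (\<exists>z. is_empty z \<and> z \<^bold>\<in> w) \<and> (\<forall>x. x \<^bold>\<in> w \<longrightarrow> (\<exists>y. is_succ x y \<and> y \<^bold>\<in> w))"

text \<open>
  In the two schemas the formula \<open>p\<close> speaks about the variables 0 (and 1); the assignment \<open>e\<close>
  supplies arbitrary parameters for its remaining free variables.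
\<close>

definition ZF_model :: bool where
  "ZF_model \<longleftrightarrow>
     \<comment> \<open>extensionality\<close>
     (\<forall>x y. (\<forall>z. z \<^bold>\<in> x \<longleftrightarrow> z \<^bold>\<in> y) \<longrightarrow> x = y) \<and>
     \<comment> \<open>foundation\<close>
     (\<forall>x. (\<exists>y. y \<^bold>\<in> x) \<longrightarrow> (\<exists>y. y \<^bold>\<in> x \<and> \<not> (\<exists>z. z \<^bold>\<in> x \<and> z \<^bold>\<in> y))) \<and>
     \<comment> \<open>pairing\<close>
     (\<forall>x y. \<exists>p. \<forall>z. z \<^bold>\<in> p \<longleftrightarrow> z = x \<or> z = y) \<and>
     \<comment> \<open>union\<close>
     (\<forall>x. \<exists>u. \<forall>z. z \<^bold>\<in> u \<longleftrightarrow> (\<exists>y. z \<^bold>\<in> y \<and> y \<^bold>\<in> x)) \<and>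
     \<comment> \<open>power set\<close>
     (\<forall>x. \<exists>p. \<forall>z. z \<^bold>\<in> p \<longleftrightarrow> z \<^bold>\<subseteq> x) \<and>
     \<comment> \<open>infinity\<close>
     (\<exists>w. is_inductive w) \<and>
     \<comment> \<open>separation\<close>
     (\<forall>p e x. \<exists>y. \<forall>z. z \<^bold>\<in> y \<longleftrightarrow> z \<^bold>\<in> x \<and> sat (\<^bold>\<in>) (e(0 := z)) p) \<and>
     \<comment> \<open>replacement\<close>
     (\<forall>p e x.
        (\<forall>u v v'. u \<^bold>\<in> x \<and> sat (\<^bold>\<in>) (e(0 := u, 1 := v)) p \<and> sat (\<^bold>\<in>) (e(0 := u, 1 := v')) p
           \<longrightarrow> v = v') \<longrightarrow>
        (\<exists>y. \<forall>v. v \<^bold>\<in> y \<longleftrightarrow> (\<exists>u. u \<^bold>\<in> x \<and> sat (\<^bold>\<in>) (e(0 := u, 1 := v)) p)))"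

section \<open>Relations, functions and natural numbers in the model\<close>

definition is_upair :: "'a \<Rightarrow> 'a \<Rightarrow> 'a \<Rightarrow> bool" where
  "is_upair x y p \<longleftrightarrow> (\<forall>z. z \<^bold>\<in> p \<longleftrightarrow> z = x \<or> z = y)"

text \<open>Kuratowski pairs: \<open>p = {{x}, {x, y}}\<close>\<close>

definition is_pair :: "'a \<Rightarrow> 'a \<Rightarrow> 'a \<Rightarrow> bool" where
  "is_pair x y p \<longleftrightarrow> (\<exists>s t. is_upair x x s \<and> is_upair x y t \<and> is_upair s t p)"

text \<open>
  \<open>related r x y\<close> says \<open>(x, y) \<in> r\<close>; for a function \<open>r\<close> this is \<open>r(x) = y\<close>.
\<close>

definition related :: "'a \<Rightarrow> 'a \<Rightarrow> 'a \<Rightarrow> bool" where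
  "related r x y \<longleftrightarrow> (\<exists>p. is_pair x y p \<and> p \<^bold>\<in> r)"

definition relation_on :: "'a \<Rightarrow> 'a \<Rightarrow> bool" where
  "relation_on M r \<longleftrightarrow> (\<forall>p. p \<^bold>\<in> r \<longrightarrow> (\<exists>x y. x \<^bold>\<in> M \<and> y \<^bold>\<in> M \<and> is_pair x y p))"

definition function_on :: "'a \<Rightarrow> 'a \<Rightarrow> bool" where
  "function_on A f \<longleftrightarrow>
     (\<forall>p. p \<^bold>\<in> f \<longrightarrow> (\<exists>x y. x \<^bold>\<in> A \<and> is_pair x y p)) \<and>
     (\<forall>x. x \<^bold>\<in> A \<longrightarrow> (\<exists>!y. related f x y))"

definition function_to :: "'a \<Rightarrow> 'a \<Rightarrow> 'a \<Rightarrow> bool" where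
  "function_to A B f \<longleftrightarrow> function_on A f \<and> (\<forall>x y. related f x y \<longrightarrow> y \<^bold>\<in> B)"

definition is_omega :: "'a \<Rightarrow> bool" where
  "is_omega w \<longleftrightarrow> is_inductive w \<and> (\<forall>v. is_inductive v \<longrightarrow> w \<^bold>\<subseteq> v)"

definition is_nat :: "'a \<Rightarrow> bool" where
  "is_nat n \<longleftrightarrow> (\<exists>w. is_omega w \<and> n \<^bold>\<in> w)"

text \<open>
  \<open>a + b = c\<close> and \<open>a \<cdot> b = c\<close> for natural numbers, by recursion on \<open>b\<close>.
\<close>

definition is_plus :: "'a \<Rightarrow> 'a \<Rightarrow> 'a \<Rightarrow> bool" where
  "is_plus a b c \<longleftrightarrow>
     (\<exists>w f z. is_omega w \<and> function_to w w f \<and> is_empty z \<and> related f z a \<and>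
        (\<forall>n s x. n \<^bold>\<in> w \<and> is_succ n s \<and> related f n x \<longrightarrow> (\<exists>y. is_succ x y \<and> related f s y)) \<and>
        related f b c)"

definition is_times :: "'a \<Rightarrow> 'a \<Rightarrow> 'a \<Rightarrow> bool" where
  "is_times a b c \<longleftrightarrow>
     (\<exists>w f z. is_omega w \<and> function_to w w f \<and> is_empty z \<and> related f z z \<and>
        (\<forall>n s x. n \<^bold>\<in> w \<and> is_succ n s \<and> related f n x \<longrightarrow> (\<exists>y. is_plus x a y \<and> related f s y)) \<and>
        related f b c)"

section \<open>Extended real numbers in the model\<close>

text \<open>
  The triple \<open>((a, b), c)\<close> of natural numbers with \<open>c \<noteq> 0\<close> denotes the rational number
  \<open>(a - b) / c\<close>.  Triples denoting the same number are not identified; since cuts are closed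
  under \<open>\<le>\<close>, they contain all representatives of a rational number or none.
\<close>

definition is_fraction :: "'a \<Rightarrow> 'a \<Rightarrow> 'a \<Rightarrow> 'a \<Rightarrow> bool" where
  "is_fraction a b c q \<longleftrightarrow>
     is_nat a \<and> is_nat b \<and> is_nat c \<and> \<not> is_empty c \<and> (\<exists>d. is_pair a b d \<and> is_pair d c q)"

definition is_rat :: "'a \<Rightarrow> bool" where
  "is_rat q \<longleftrightarrow> (\<exists>a b c. is_fraction a b c q)"

text \<open>
  For \<open>p = (a - b) / c\<close> and \<open>q = (a' - b') / c'\<close> the natural numbers \<open>s = a c' + b' c\<close> and
  \<open>t = a' c + b c'\<close> compare like \<open>p\<close> and \<open>q\<close>.
\<close>

definition cross_sums :: "'a \<Rightarrow> 'a \<Rightarrow> 'a \<Rightarrow> 'a \<Rightarrow> bool" where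
  "cross_sums p q s t \<longleftrightarrow>
     (\<exists>a b c a' b' c' k l m n. is_fraction a b c p \<and> is_fraction a' b' c' q \<and>
        is_times a c' k \<and> is_times b' c l \<and> is_plus k l s \<and>
        is_times a' c m \<and> is_times b c' n \<and> is_plus m n t)"

definition rat_le :: "'a \<Rightarrow> 'a \<Rightarrow> bool" where
  "rat_le p q \<longleftrightarrow> (\<exists>s t. cross_sums p q s t \<and> s \<^bold>\<subseteq> t)"

definition rat_less :: "'a \<Rightarrow> 'a \<Rightarrow> bool" where
  "rat_less p q \<longleftrightarrow> (\<exists>s t. cross_sums p q s t \<and> s \<^bold>\<in> t)"

text \<open>
  Dedekind cuts: downward closed sets of rational numbers without a greatest element, ordered by
  inclusion.  The improper cuts, the empty set and the set of all rational numbers, are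
  \<open>-\<infinity>\<close> and \<open>\<infinity>\<close>; the other cuts are the real numbers.
\<close>

definition is_ereal :: "'a \<Rightarrow> bool" where
  "is_ereal x \<longleftrightarrow>
     (\<forall>q. q \<^bold>\<in> x \<longrightarrow> is_rat q) \<and>
     (\<forall>p q. q \<^bold>\<in> x \<and> rat_le p q \<longrightarrow> p \<^bold>\<in> x) \<and>
     (\<forall>q. q \<^bold>\<in> x \<longrightarrow> (\<exists>r. r \<^bold>\<in> x \<and> rat_less q r))"

definition is_minus_inf :: "'a \<Rightarrow> bool" where
  "is_minus_inf x \<longleftrightarrow> is_empty x"

definition is_plus_inf :: "'a \<Rightarrow> bool" where
  "is_plus_inf x \<longleftrightarrow> (\<forall>q. q \<^bold>\<in> x \<longleftrightarrow> is_rat q)"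

definition is_real :: "'a \<Rightarrow> bool" where
  "is_real x \<longleftrightarrow> is_ereal x \<and> \<not> is_minus_inf x \<and> \<not> is_plus_inf x"

definition is_real_zero :: "'a \<Rightarrow> bool" where
  "is_real_zero x \<longleftrightarrow> (\<forall>q. q \<^bold>\<in> x \<longleftrightarrow> (\<exists>a b c. is_fraction a b c q \<and> a \<^bold>\<in> b))"

definition ereal_le :: "'a \<Rightarrow> 'a \<Rightarrow> bool" where
  "ereal_le x y \<longleftrightarrow> is_ereal x \<and> is_ereal y \<and> x \<^bold>\<subseteq> y"

definition ereal_less :: "'a \<Rightarrow> 'a \<Rightarrow> bool" where
  "ereal_less x y \<longleftrightarrow> ereal_le x y \<and> x \<noteq> y"

text \<open>Infimum and supremum of the range of a function \<open>\<phi>\<close>, in the extended reals\<close>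

definition is_inf :: "'a \<Rightarrow> 'a \<Rightarrow> bool" where
  "is_inf \<phi> g \<longleftrightarrow> is_ereal g \<and> (\<forall>x y. related \<phi> x y \<longrightarrow> ereal_le g y) \<and>
     (\<forall>h. is_ereal h \<and> (\<forall>x y. related \<phi> x y \<longrightarrow> ereal_le h y) \<longrightarrow> ereal_le h g)"

definition is_sup :: "'a \<Rightarrow> 'a \<Rightarrow> bool" where
  "is_sup \<phi> g \<longleftrightarrow> is_ereal g \<and> (\<forall>x y. related \<phi> x y \<longrightarrow> ereal_le y g) \<and>
     (\<forall>h. is_ereal h \<and> (\<forall>x y. related \<phi> x y \<longrightarrow> ereal_le y h) \<longrightarrow> ereal_le g h)"

section \<open>Dependent choices\<close>

definition DC :: bool where
  "DC \<longleftrightarrow>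
     (\<forall>M R a. (\<exists>x. x \<^bold>\<in> M) \<and> relation_on M R \<and>
        (\<forall>x. x \<^bold>\<in> M \<longrightarrow> (\<exists>y. y \<^bold>\<in> M \<and> related R x y)) \<and> a \<^bold>\<in> M \<longrightarrow>
        (\<exists>w f. is_omega w \<and> function_to w M f \<and>
           (\<exists>z. is_empty z \<and> related f z a) \<and>
           (\<forall>n. n \<^bold>\<in> w \<longrightarrow>
              (\<exists>s x y. is_succ n s \<and> related f n x \<and> related f s y \<and> related R x y))))"

section \<open>The gauge ordering principles\<close>

definition quasi_order :: "'a \<Rightarrow> 'a \<Rightarrow> bool" where
  "quasi_order M le \<longleftrightarrow> relation_on M le \<and> (\<forall>x. x \<^bold>\<in> M \<longrightarrow> related le x x) \<and>
     (\<forall>x y z. related le x y \<and> related le y z \<longrightarrow> related le x z)"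

definition ascending :: "'a \<Rightarrow> 'a \<Rightarrow> bool" where
  "ascending le f \<longleftrightarrow>
     (\<forall>n m x y. (n \<^bold>\<in> m \<or> n = m) \<and> related f n x \<and> related f m y \<longrightarrow> related le x y)"

definition sequentially_inductive :: "'a \<Rightarrow> 'a \<Rightarrow> bool" where
  "sequentially_inductive M le \<longleftrightarrow>
     (\<forall>w f. is_omega w \<and> function_to w M f \<and> ascending le f \<longrightarrow>
        (\<exists>u. u \<^bold>\<in> M \<and> (\<forall>n x. related f n x \<longrightarrow> related le x u)))"

definition ereal_function :: "'a \<Rightarrow> 'a \<Rightarrow> bool" where
  "ereal_function M \<phi> \<longleftrightarrow> function_on M \<phi> \<and> (\<forall>x y. related \<phi> x y \<longrightarrow> is_ereal y)"

definition decreasing :: "'a \<Rightarrow> 'a \<Rightarrow> bool" where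
  "decreasing le \<phi> \<longleftrightarrow>
     (\<forall>x1 x2 y1 y2. related le x1 x2 \<and> related \<phi> x1 y1 \<and> related \<phi> x2 y2 \<longrightarrow> ereal_le y2 y1)"

definition maximal_point :: "'a \<Rightarrow> 'a \<Rightarrow> 'a \<Rightarrow> 'a \<Rightarrow> bool" where
  "maximal_point M le \<phi> z \<longleftrightarrow> z \<^bold>\<in> M \<and>
     (\<forall>w. w \<^bold>\<in> M \<and> related le z w \<longrightarrow> (\<exists>y. related \<phi> z y \<and> related \<phi> w y))"

text \<open>\<open>z \<in> max(M; \<le>; \<Phi>)\<close>\<close>

definition max_point :: "'a \<Rightarrow> 'a \<Rightarrow> 'a \<Rightarrow> 'a \<Rightarrow> bool" where
  "max_point M le \<Phi> z \<longleftrightarrow> z \<^bold>\<in> M \<and> (\<forall>i \<phi>. related \<Phi> i \<phi> \<longrightarrow> maximal_point M le \<phi> z)"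

definition reals_only :: "'a \<Rightarrow> bool" where
  "reals_only \<phi> \<longleftrightarrow> (\<forall>x y. related \<phi> x y \<longrightarrow> is_real y)"

definition reals_or_plus_inf :: "'a \<Rightarrow> bool" where
  "reals_or_plus_inf \<phi> \<longleftrightarrow> (\<forall>x y. related \<phi> x y \<longrightarrow> is_real y \<or> is_plus_inf y)"

definition inf_above_minus_inf :: "'a \<Rightarrow> bool" where
  "inf_above_minus_inf \<phi> \<longleftrightarrow> (\<exists>g m. is_inf \<phi> g \<and> is_minus_inf m \<and> ereal_less m g)"

definition sup_below_plus_inf :: "'a \<Rightarrow> bool" where
  "sup_below_plus_inf \<phi> \<longleftrightarrow> (\<exists>g m. is_sup \<phi> g \<and> is_plus_inf m \<and> ereal_less g m)"

definition inf_nonneg :: "'a \<Rightarrow> bool" where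
  "inf_nonneg \<phi> \<longleftrightarrow> (\<exists>g z. is_inf \<phi> g \<and> is_real_zero z \<and> ereal_le z g)"

end

datatype range_class = P1 | P2 | P3 | P4 | P5 | P6

primrec in_range_class :: "('a \<Rightarrow> 'a \<Rightarrow> bool) \<Rightarrow> range_class \<Rightarrow> 'a \<Rightarrow> bool" where
  "in_range_class E P1 \<phi> \<longleftrightarrow>
     reals_only E \<phi> \<and> inf_above_minus_inf E \<phi> \<and> sup_below_plus_inf E \<phi>"
| "in_range_class E P2 \<phi> \<longleftrightarrow> True"
| "in_range_class E P3 \<phi> \<longleftrightarrow> reals_or_plus_inf E \<phi> \<and> inf_above_minus_inf E \<phi>"
| "in_range_class E P4 \<phi> \<longleftrightarrow> reals_or_plus_inf E \<phi> \<and> inf_nonneg E \<phi>"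
| "in_range_class E P5 \<phi> \<longleftrightarrow> reals_only E \<phi> \<and> inf_above_minus_inf E \<phi>"
| "in_range_class E P6 \<phi> \<longleftrightarrow> reals_only E \<phi> \<and> inf_nonneg E \<phi>"

definition BBg :: "('a \<Rightarrow> 'a \<Rightarrow> bool) \<Rightarrow> range_class \<Rightarrow> bool" where
  "BBg E j \<longleftrightarrow>
     (\<forall>M le w \<Phi>. (\<exists>x. E x M) \<and> quasi_order E M le \<and> sequentially_inductive E M le \<and>
        is_omega E w \<and> function_on E w \<Phi> \<and>
        (\<forall>i \<phi>. related E \<Phi> i \<phi> \<longrightarrow>
           ereal_function E M \<phi> \<and> decreasing E le \<phi> \<and> in_range_class E j \<phi>) \<longrightarrow>
        (\<forall>u. E u M \<longrightarrow> (\<exists>v. max_point E M le \<Phi> v \<and> related E le u v)) \<and>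
        (\<forall>u v. max_point E M le \<Phi> u \<and> E v M \<and> related E le u v \<longrightarrow> max_point E M le \<Phi> v))"

end

theory Submission
  imports Defs
begin

text \<open>
  Each of the six principles is a special case of (BBg-P2).  Two facts about extended reals carry
  its proof: they are ordered by inclusion, and each is a subset of a set that is indexed by triples
  of natural numbers.

  Along the order \<open>\<le>\<close> a decreasing function \<open>\<phi>\<close> can only lose rational numbers \<open>q \<in> \<phi>(x)\<close>.
  Call \<open>q\<close> settled at \<open>x\<close> if it is not lost above \<open>x\<close>.  The points at which \<open>q\<close> is
  settled form an upward closed cofinal set: above \<open>u\<close> either \<open>q\<close> is lost at some point, and
  then this point settles \<open>q\<close>, or it is not lost and \<open>u\<close> settles \<open>q\<close>.  A point that settles all
  rational numbers for all \<open>\<phi>\<^sub>i\<close> is \<open>(\<le>, \<phi>\<^sub>i)\<close>-maximal for all \<open>i\<close>.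
  Invariance of the set of maximal points is immediate, since the points above \<open>v \<ge> u\<close> are among
  those above \<open>u\<close>.

  So the theorem is the following Baire type statement (\<open>open_dense_INT\<close>): in a sequentially
  inductive quasi-order, DC implies that the intersection of a sequence \<open>(D\<^sub>n)\<close> of upward closed
  cofinal sets is upward closed and cofinal.  It is used four times, once for the index \<open>i\<close> and
  once for each of the natural numbers \<open>a\<close>, \<open>b\<close>, \<open>c\<close> that describe a rational number
  \<open>(a - b) / c\<close>; this nesting takes the place of an enumeration of quadruples of natural
  numbers inside the model.  To prove the Baire type statement, relate \<open>x\<close> to \<open>y\<close>
  if \<open>x \<le> y\<close> and \<open>y\<close> lies in \<open>D\<^sub>n\<close> for the first \<open>n\<close> with \<open>x \<notin> D\<^sub>n\<close>, if there is one.
  A chain \<open>(x\<^sub>k)\<close> for this relation satisfies \<open>x\<^sub>k \<in> D\<^sub>m\<close> for \<open>m < k\<close>, and so its upper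
  bounds lie in all \<open>D\<^sub>n\<close>.

  Working in a model of ZF, sets can be formed by separation only from predicates that are given by
  formulas with parameters; the closure rules for definability below let such predicates be
  written as HOL predicates.
\<close>

section \<open>Definability with parameters\<close>

text \<open>
  A formula has finitely many variables, so fresh variables are available in \<open>sat_rename\<close>.
\<close>

lemma sat_cong:
  "\<exists>N. \<forall>e e'. (\<forall>n<N. e n = e' n) \<longrightarrow> sat E e p = sat E e' p"
proof (induction p)
  case (Mem i j)
  show ?case by (rule exI[of _ "Suc (max i j)"]) simp
next
  case (Equal i j)
  show ?case by (rule exI[of _ "Suc (max i j)"]) simp
next
  case (Neg p)
  then show ?case by (metis sat.simps(3))
next
  case (Conj p q)
  then obtain N1 N2 where
    "\<forall>e e'. (\<forall>n<N1. e n = e' n) \<longrightarrow> sat E e p = sat E e' p"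
    "\<forall>e e'. (\<forall>n<N2. e n = e' n) \<longrightarrow> sat E e q = sat E e' q"
    by blast
  then have "\<forall>e e'. (\<forall>n<max N1 N2. e n = e' n) \<longrightarrow> sat E e (Conj p q) = sat E e' (Conj p q)"
    by (metis less_max_iff_disj sat.simps(4))
  then show ?case by blast
next
  case (Exists i p)
  then obtain N where N: "\<And>e e'. (\<forall>n<N. e n = e' n) \<Longrightarrow> sat E e p = sat E e' p"
    by blast
  have "sat E (e(i := x)) p = sat E (e'(i := x)) p" if "\<forall>n<N. e n = e' n" for e e' x
    using that by (intro N) simp
  then have "\<forall>e e'. (\<forall>n<N. e n = e' n) \<longrightarrow>
      sat E e (Exists i p) = sat E e' (Exists i p)"
    unfolding sat.simps by blast
  then show ?case by blast
qed

text \<open>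
  Even if \<open>h\<close> identifies variables, capture is avoided by renaming a bound variable to one that
  lies beyond the images of all variables that occur.
\<close>

lemma sat_rename:
  "\<exists>q. \<forall>e. sat E e q \<longleftrightarrow> sat E (\<lambda>n. e (h n)) p"
proof (induction p arbitrary: h)
  case (Mem i j)
  show ?case by (rule exI[of _ "Mem (h i) (h j)"]) simp
next
  case (Equal i j)
  show ?case by (rule exI[of _ "Equal (h i) (h j)"]) simp
next
  case (Neg p)
  then show ?case by (metis sat.simps(3))
next
  case (Conj p q)
  from Conj[of h] show ?case by (metis sat.simps(4))
next
  case (Exists i p)
  obtain N where N: "\<And>e e'. (\<forall>n<N. e n = e' n) \<Longrightarrow> sat E e p = sat E e' p"
    using sat_cong[of E p] by blast
  obtain k where k: "\<And>n. n < N \<Longrightarrow> h n < k"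
    using finite_nat_set_iff_bounded[of "h ` {..<N}"] by auto
  obtain q where q: "\<And>e. sat E e q \<longleftrightarrow> sat E (\<lambda>n. e ((h(i := k)) n)) p"
    using Exists[of "h(i := k)"] by blast
  have "sat E (e(k := x)) q \<longleftrightarrow> sat E ((\<lambda>n. e (h n))(i := x)) p" for e x
    unfolding q using k by (intro N) fastforce
  then have "sat E e (Exists k q) \<longleftrightarrow> sat E (\<lambda>n. e (h n)) (Exists i p)" for e
    by simp
  then show ?case by blast
qed

text \<open>
  A variable of a formula is assigned either an entry of the environment or a parameter.
\<close>

definition lookup :: "(nat \<Rightarrow> 'a) \<Rightarrow> nat + 'a \<Rightarrow> 'a" where
  "lookup e v = (case v of Inl i \<Rightarrow> e i | Inr a \<Rightarrow> a)"

lemma lookup_simps [simp]: "lookup e (Inl i) = e i" "lookup e (Inr a) = a"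
  by (simp_all add: lookup_def)

definition definable :: "('a \<Rightarrow> 'a \<Rightarrow> bool) \<Rightarrow> ((nat \<Rightarrow> 'a) \<Rightarrow> bool) \<Rightarrow> bool" where
  "definable E P \<longleftrightarrow> (\<exists>p f. \<forall>e. P e \<longleftrightarrow> sat E (\<lambda>n. lookup e (f n)) p)"

definition is_term :: "((nat \<Rightarrow> 'a) \<Rightarrow> 'a) \<Rightarrow> bool" where
  "is_term t \<longleftrightarrow> (\<exists>v. \<forall>e. t e = lookup e v)"

lemma is_term_var: "is_term (\<lambda>e. e i)"
  unfolding is_term_def by (rule exI[of _ "Inl i"]) simp

lemma is_term_param: "is_term (\<lambda>e. a)"
  unfolding is_term_def by (rule exI[of _ "Inr a"]) simp

lemma definable_subst:
  assumes "definable E P" and "\<And>i. is_term (t i)"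
  shows "definable E (\<lambda>e. P (\<lambda>i. t i e))"
proof -
  obtain p f where pf: "\<And>e. P e \<longleftrightarrow> sat E (\<lambda>n. lookup e (f n)) p"
    using assms(1) unfolding definable_def by blast
  obtain v where v: "\<And>i e. t i e = lookup e (v i)"
    using assms(2) unfolding is_term_def by metis
  define g where "g n = (case f n of Inl i \<Rightarrow> v i | Inr a \<Rightarrow> Inr a)" for n
  have "lookup (\<lambda>i. t i e) (f n) = lookup e (g n)" for e n
    by (simp add: g_def v split: sum.split)
  then show ?thesis
    unfolding definable_def pf by auto
qed

lemma definable_subst2:
  assumes "definable E (\<lambda>e. P (e 0) (e 1))" and "is_term s" and "is_term t"
  shows "definable E (\<lambda>e. P (s e) (t e))"
proof -
  have "is_term (((\<lambda>_. t)(0 := s)) i)" for i :: nat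
    using assms(2,3) by simp
  from definable_subst[of E _ "(\<lambda>_. t)(0 := s)", OF assms(1) this] show ?thesis by simp
qed

lemma definable_subst3:
  assumes "definable E (\<lambda>e. P (e 0) (e 1) (e 2))"
    and "is_term s" and "is_term t" and "is_term u"
  shows "definable E (\<lambda>e. P (s e) (t e) (u e))"
proof -
  have "is_term (((\<lambda>_. u)(0 := s, 1 := t)) i)" for i :: nat
    using assms(2-4) by simp
  from definable_subst[of E _ "(\<lambda>_. u)(0 := s, 1 := t)", OF assms(1) this] show ?thesis by simp
qed

lemma definable_mem:
  assumes "is_term s" and "is_term t"
  shows "definable E (\<lambda>e. E (s e) (t e))"
proof (rule definable_subst2[where P = E, OF _ assms])
  show "definable E (\<lambda>e. E (e 0) (e 1))"
    unfolding definable_def by (intro exI[of _ "Mem 0 1"] exI[of _ Inl]) simp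
qed

lemma definable_eq:
  assumes "is_term s" and "is_term t"
  shows "definable E (\<lambda>e. s e = t e)"
proof (rule definable_subst2[where P = "(=)", OF _ assms])
  show "definable E (\<lambda>e. e 0 = e 1)"
    unfolding definable_def by (intro exI[of _ "Equal 0 1"] exI[of _ Inl]) simp
qed

lemma definable_neg:
  assumes "definable E P"
  shows "definable E (\<lambda>e. \<not> P e)"
  using assms unfolding definable_def by (metis sat.simps(3))

lemma definable_conj:
  assumes "definable E P" and "definable E Q"
  shows "definable E (\<lambda>e. P e \<and> Q e)"
proof -
  obtain p f where p: "\<And>e. P e \<longleftrightarrow> sat E (\<lambda>n. lookup e (f n)) p"
    using assms(1) unfolding definable_def by blast
  obtain q g where q: "\<And>e. Q e \<longleftrightarrow> sat E (\<lambda>n. lookup e (g n)) q"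
    using assms(2) unfolding definable_def by blast
  \<comment> \<open>The variables of \<open>p\<close> become the even ones, those of \<open>q\<close> the odd ones.\<close>
  obtain p' where p': "\<And>e. sat E e p' \<longleftrightarrow> sat E (\<lambda>n. e (2 * n)) p"
    using sat_rename[of E "\<lambda>n. 2 * n" p] by blast
  obtain q' where q': "\<And>e. sat E e q' \<longleftrightarrow> sat E (\<lambda>n. e (Suc (2 * n))) q"
    using sat_rename[of E "\<lambda>n. Suc (2 * n)" q] by blast
  define k where "k n = (if even n then f (n div 2) else g (n div 2))" for n
  have "P e \<and> Q e \<longleftrightarrow> sat E (\<lambda>n. lookup e (k n)) (Conj p' q')" for e
    by (simp add: p q p' q' k_def)
  then show ?thesis unfolding definable_def by blast
qed

text \<open>
  A de Bruijn style rule: below the quantifier, the bound variable is entry 0 of the environment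
  and the other entries move up by one.
\<close>

lemma definable_ex:
  assumes "definable E (\<lambda>e. P (e 0) (\<lambda>n. e (Suc n)))"
  shows "definable E (\<lambda>e. \<exists>x. P x e)"
proof -
  obtain p f where p: "\<And>e. P (e 0) (\<lambda>n. e (Suc n)) \<longleftrightarrow> sat E (\<lambda>n. lookup e (f n)) p"
    using assms unfolding definable_def by blast
  \<comment> \<open>All variables of \<open>p\<close> that look up entry 0 are identified with the variable 0.\<close>
  obtain q where q: "\<And>e. sat E e q \<longleftrightarrow> sat E (\<lambda>n. e (if f n = Inl 0 then 0 else Suc n)) p"
    using sat_rename[of E "\<lambda>n. if f n = Inl 0 then 0 else Suc n" p] by blast
  \<comment> \<open>This undoes two shifts: the variable \<open>Suc n\<close> of \<open>q\<close> comes from the variable \<open>n\<close> of \<open>p\<close>, and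
    entry \<open>Suc i\<close> of the environment below the quantifier is entry \<open>i\<close> above it.\<close>
  define g where "g n = (case f (n - 1) of Inl i \<Rightarrow> Inl (i - 1) | Inr a \<Rightarrow> Inr a)" for n
  have "P x e \<longleftrightarrow> sat E ((\<lambda>n. lookup e (g n))(0 := x)) q" for x e
  proof -
    have *: "lookup (case_nat x e) (f n) =
        ((\<lambda>n. lookup e (g n))(0 := x)) (if f n = Inl 0 then 0 else Suc n)" for n
      by (auto simp: g_def split: sum.split nat.split)
    show ?thesis
      using p[of "case_nat x e"] unfolding q * by simp
  qed
  then have "(\<exists>x. P x e) \<longleftrightarrow> sat E (\<lambda>n. lookup e (g n)) (Exists 0 q)" for e
    by simp
  then show ?thesis unfolding definable_def by blast
qed

lemma definable_disj:
  assumes "definable E P" and "definable E Q"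
  shows "definable E (\<lambda>e. P e \<or> Q e)"
  using definable_neg[OF definable_conj[OF definable_neg[OF assms(1)] definable_neg[OF assms(2)]]]
  by simp

lemma definable_imp:
  assumes "definable E P" and "definable E Q"
  shows "definable E (\<lambda>e. P e \<longrightarrow> Q e)"
  using definable_disj[OF definable_neg[OF assms(1)] assms(2)] by simp

lemma definable_iff:
  assumes "definable E P" and "definable E Q"
  shows "definable E (\<lambda>e. P e \<longleftrightarrow> Q e)"
  unfolding iff_conv_conj_imp by (intro definable_conj definable_imp assms)

lemma definable_all:
  assumes "definable E (\<lambda>e. P (e 0) (\<lambda>n. e (Suc n)))"
  shows "definable E (\<lambda>e. \<forall>x. P x e)"
  using definable_neg[OF definable_ex[OF definable_neg[OF assms]]] by simp

lemmas definable_logic =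
  definable_neg definable_conj definable_disj definable_imp definable_iff
  definable_ex definable_all definable_mem definable_eq
  is_term_var is_term_param

lemma definable_is_pair:
  assumes "is_term s" and "is_term t" and "is_term u"
  shows "definable E (\<lambda>e. is_pair E (s e) (t e) (u e))"
proof (rule definable_subst3[where P = "is_pair E", OF _ assms])
  show "definable E (\<lambda>e. is_pair E (e 0) (e 1) (e 2))"
    unfolding is_pair_def is_upair_def by (intro definable_logic)
qed

lemma definable_related:
  assumes "is_term r" and "is_term s" and "is_term t"
  shows "definable E (\<lambda>e. related E (r e) (s e) (t e))"
proof (rule definable_subst3[where P = "related E", OF _ assms])
  show "definable E (\<lambda>e. related E (e 0) (e 1) (e 2))"
    unfolding related_def by (intro definable_logic definable_is_pair)
qed

lemmas definable_intros = definable_logic definable_is_pair definable_related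

section \<open>Sets and natural numbers in a model of ZF\<close>

locale zf_model =
  fixes E :: "'a \<Rightarrow> 'a \<Rightarrow> bool"  (infix "\<^bold>\<in>" 50)
  assumes ZF: "ZF_model E"
begin

lemma extensionality: "(\<And>z. z \<^bold>\<in> x \<longleftrightarrow> z \<^bold>\<in> y) \<Longrightarrow> x = y"
  using ZF[unfolded ZF_model_def, THEN conjunct1] by simp

lemma separation:
  assumes "definable E (\<lambda>e. P (e 0))"
  shows "\<exists>y. \<forall>z. z \<^bold>\<in> y \<longleftrightarrow> z \<^bold>\<in> x \<and> P z"
proof -
  obtain p f where p: "\<And>e. P (e 0) \<longleftrightarrow> sat E (\<lambda>n. lookup e (f n)) p"
    using assms unfolding definable_def by blast
  \<comment> \<open>Variables that look up the environment become the variable 0 of the separation schema, the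
    others are supplied by its assignment.\<close>
  obtain q where q: "\<And>e. sat E e q \<longleftrightarrow> sat E (\<lambda>n. e (if isl (f n) then 0 else Suc n)) p"
    using sat_rename[of E "\<lambda>n. if isl (f n) then 0 else Suc n" p] by blast
  define e where "e n = projr (f (n - 1))" for n
  have "P z \<longleftrightarrow> sat E (e(0 := z)) q" for z
  proof -
    have *: "lookup (\<lambda>_. z) (f n) = (e(0 := z)) (if isl (f n) then 0 else Suc n)" for n
      by (cases "f n") (simp_all add: e_def)
    show ?thesis
      using p[of "\<lambda>_. z"] unfolding q * by simp
  qed
  moreover have "\<forall>p e x. \<exists>y. \<forall>z. z \<^bold>\<in> y \<longleftrightarrow> z \<^bold>\<in> x \<and> sat E (e(0 := z)) p"
    using ZF unfolding ZF_model_def by (elim conjE)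
  ultimately show ?thesis by simp
qed

lemma is_upair_unique: "is_upair E x y p \<Longrightarrow> is_upair E x y q \<Longrightarrow> p = q"
  unfolding is_upair_def by (rule extensionality) blast

lemma is_pair_unique: "is_pair E x y p \<Longrightarrow> is_pair E x y q \<Longrightarrow> p = q"
  unfolding is_pair_def using is_upair_unique by metis

lemma is_pair_inject:
  assumes "is_pair E x y p" and "is_pair E x' y' p"
  shows "x = x' \<and> y = y'"
proof -
  obtain s t where st: "is_upair E x x s" "is_upair E x y t" "is_upair E s t p"
    using assms(1) unfolding is_pair_def by blast
  obtain s' t' where st': "is_upair E x' x' s'" "is_upair E x' y' t'" "is_upair E s' t' p"
    using assms(2) unfolding is_pair_def by blast
  have "s = s' \<and> t = t' \<or> s = t' \<and> t = s'"
    using st(3) st'(3) unfolding is_upair_def by metis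
  then show ?thesis
    using st(1,2) st'(1,2) unfolding is_upair_def by metis
qed

lemma relation_on_related:
  "relation_on E M r \<Longrightarrow> related E r x y \<Longrightarrow> x \<^bold>\<in> M \<and> y \<^bold>\<in> M"
  unfolding relation_on_def related_def using is_pair_inject by metis

lemma function_on_domain: "function_on E A f \<Longrightarrow> related E f x y \<Longrightarrow> x \<^bold>\<in> A"
  unfolding function_on_def related_def using is_pair_inject by metis

lemma function_on_unique:
  "function_on E A f \<Longrightarrow> related E f x y \<Longrightarrow> related E f x y' \<Longrightarrow> y = y'"
  using function_on_domain unfolding function_on_def by metis

lemma function_on_value:
  assumes "function_on E A f" and "x \<^bold>\<in> A"
  obtains y where "related E f x y"
  using assms unfolding function_on_def by blast

lemma is_empty_unique: "is_empty E x \<Longrightarrow> is_empty E y \<Longrightarrow> x = y"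
  unfolding is_empty_def by (rule extensionality) blast

lemma is_succ_unique: "is_succ E x y \<Longrightarrow> is_succ E x y' \<Longrightarrow> y = y'"
  unfolding is_succ_def by (rule extensionality) blast

lemma is_succ_mem: "is_succ E n s \<Longrightarrow> m \<^bold>\<in> s \<longleftrightarrow> m \<^bold>\<in> n \<or> m = n"
  unfolding is_succ_def by blast

lemma is_omega_unique: "is_omega E w \<Longrightarrow> is_omega E v \<Longrightarrow> w = v"
  unfolding is_omega_def is_subset_def by (rule extensionality) blast

lemma is_nat_mem_omega: "is_omega E w \<Longrightarrow> is_nat E n \<Longrightarrow> n \<^bold>\<in> w"
  unfolding is_nat_def using is_omega_unique by metis

lemma omega_succ:
  assumes "is_omega E w" and "n \<^bold>\<in> w"
  obtains s where "is_succ E n s" "s \<^bold>\<in> w"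
  using assms unfolding is_omega_def is_inductive_def by blast

lemma omega_induct [consumes 2, case_names definable zero succ]:
  assumes w: "is_omega E w" and "n \<^bold>\<in> w"
    and P: "definable E (\<lambda>e. P (e 0))"
    and zero: "\<And>z. is_empty E z \<Longrightarrow> P z"
    and succ: "\<And>n s. n \<^bold>\<in> w \<Longrightarrow> P n \<Longrightarrow> is_succ E n s \<Longrightarrow> P s"
  shows "P n"
proof -
  obtain v where v: "\<And>n. n \<^bold>\<in> v \<longleftrightarrow> n \<^bold>\<in> w \<and> P n"
    using separation[OF P, of w] by blast
  have "is_inductive E v"
    unfolding is_inductive_def
  proof (intro conjI allI impI)
    show "\<exists>z. is_empty E z \<and> z \<^bold>\<in> v"
      using w zero v unfolding is_omega_def is_inductive_def by blast
  next
    fix n assume "n \<^bold>\<in> v"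
    moreover from this obtain s where "is_succ E n s" "s \<^bold>\<in> w"
      using omega_succ[OF w] v by blast
    ultimately show "\<exists>s. is_succ E n s \<and> s \<^bold>\<in> v" using v succ by blast
  qed
  then show ?thesis
    using w \<open>n \<^bold>\<in> w\<close> v unfolding is_omega_def is_subset_def by blast
qed

lemma omega_transitive:
  assumes w: "is_omega E w" and n: "n \<^bold>\<in> w" and "m \<^bold>\<in> n"
  shows "m \<^bold>\<in> w"
proof -
  from w n have "\<forall>m. m \<^bold>\<in> n \<longrightarrow> m \<^bold>\<in> w"
  proof (induct rule: omega_induct)
    case definable show ?case by (intro definable_intros)
  qed (auto simp: is_empty_def is_succ_mem)
  then show ?thesis using \<open>m \<^bold>\<in> n\<close> by blast
qed

lemma omega_zero_le:
  assumes w: "is_omega E w" and n: "n \<^bold>\<in> w" and z: "is_empty E z"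
  shows "z \<^bold>\<in> n \<or> z = n"
  using w n
proof (induct rule: omega_induct)
  case definable show ?case by (intro definable_intros)
qed (use z is_empty_unique in \<open>auto simp: is_succ_mem\<close>)

lemma omega_succ_le:
  assumes w: "is_omega E w" and n: "n \<^bold>\<in> w" and m: "m \<^bold>\<in> n" and s: "is_succ E m s"
  shows "s \<^bold>\<in> n \<or> s = n"
proof -
  from w n have "m \<^bold>\<in> n \<longrightarrow> s \<^bold>\<in> n \<or> s = n"
  proof (induct rule: omega_induct)
    case definable show ?case by (intro definable_intros)
  next
    case zero then show ?case by (simp add: is_empty_def)
  next
    case succ then show ?case using s is_succ_unique is_succ_mem by metis
  qed
  then show ?thesis using m by blast
qed

text \<open>
  Comparability makes the first \<open>n\<close> with \<open>x \<notin> D\<^sub>n\<close> unique in the proof of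
  \<open>open_dense_INT\<close>.
\<close>

lemma omega_linear:
  assumes w: "is_omega E w" and m: "m \<^bold>\<in> w" and n: "n \<^bold>\<in> w"
  shows "m \<^bold>\<in> n \<or> m = n \<or> n \<^bold>\<in> m"
  using w m
proof (induct rule: omega_induct)
  case definable show ?case by (intro definable_intros)
next
  case zero then show ?case using omega_zero_le[OF w n] by blast
next
  case succ then show ?case using omega_succ_le[OF w n] is_succ_mem by metis
qed

section \<open>Intersections of upward closed cofinal sets\<close>

text \<open>
  On \<open>M\<close>, these are the dense open sets of the topology whose open sets are the upward closed
  ones: there, dense means cofinal.
\<close>

definition open_dense :: "'a \<Rightarrow> 'a \<Rightarrow> ('a \<Rightarrow> bool) \<Rightarrow> bool" where
  "open_dense M le D \<longleftrightarrow>
     (\<forall>x y. D x \<and> related E le x y \<longrightarrow> D y) \<and>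
     (\<forall>x. x \<^bold>\<in> M \<longrightarrow> (\<exists>y. related E le x y \<and> D y))"

lemma open_dense_cofinal:
  "open_dense M le D \<Longrightarrow> x \<^bold>\<in> M \<Longrightarrow> \<exists>y. related E le x y \<and> D y"
  unfolding open_dense_def by blast

lemma quasi_order_refl: "quasi_order E M le \<Longrightarrow> x \<^bold>\<in> M \<Longrightarrow> related E le x x"
  unfolding quasi_order_def by blast

lemma quasi_order_trans:
  "quasi_order E M le \<Longrightarrow> related E le x y \<Longrightarrow> related E le y z \<Longrightarrow> related E le x z"
  unfolding quasi_order_def by blast

lemma quasi_order_field:
  "quasi_order E M le \<Longrightarrow> related E le x y \<Longrightarrow> x \<^bold>\<in> M \<and> y \<^bold>\<in> M"
  unfolding quasi_order_def using relation_on_related by blast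

lemma ascending_if_steps:
  assumes le: "quasi_order E M le" and w: "is_omega E w" and f: "function_to E w M f"
    and step: "\<And>n s x y. is_succ E n s \<Longrightarrow> related E f n x \<Longrightarrow> related E f s y \<Longrightarrow>
      related E le x y"
  shows "ascending E le f"
proof -
  have fn: "function_on E w f" and fM: "\<And>n x. related E f n x \<Longrightarrow> x \<^bold>\<in> M"
    using f unfolding function_to_def by blast+
  have refl: "related E le x y" if "related E f n x" "related E f n y" for n x y
    using that function_on_unique[OF fn] fM quasi_order_refl[OF le] by metis
  have asc: "\<forall>n x y. (n \<^bold>\<in> m \<or> n = m) \<and> related E f n x \<and> related E f m y \<longrightarrow> related E le x y"
    if "m \<^bold>\<in> w" for m
    using w that
  proof (induct rule: omega_induct)
    case definable show ?case by (intro definable_intros)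
  next
    case zero then show ?case using refl by (auto simp: is_empty_def)
  next
    case (succ m s)
    obtain x' where x': "related E f m x'"
      using function_on_value[OF fn succ(1)] by blast
    show ?case
    proof (intro allI impI, elim conjE)
      fix n x y assume n: "n \<^bold>\<in> s \<or> n = s" and x: "related E f n x" and y: "related E f s y"
      show "related E le x y"
      proof (cases "n = s")
        case True then show ?thesis using x y refl by blast
      next
        case False
        then have "n \<^bold>\<in> m \<or> n = m" using n is_succ_mem[OF succ(3)] by blast
        then have "related E le x x'" using succ(2) x x' by blast
        then show ?thesis using step[OF succ(3) x' y] quasi_order_trans[OF le] by blast
      qed
    qed
  qed
  then show ?thesis
    unfolding ascending_def using function_on_domain[OF fn] by blast
qed

text \<open>
  The heart of the proof.  DC is applied to \<open>M\<close> itself and not to pairs of a natural number and a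
  point: a point \<open>x\<close> determines the index that is to be treated next, namely the first \<open>n\<close> such
  that \<open>x\<close> is outside \<open>D\<^sub>n\<close>.
\<close>

lemma open_dense_INT:
  assumes DC: "DC E" and le: "quasi_order E M le" and ind: "sequentially_inductive E M le"
    and w: "is_omega E w" and def_D: "definable E (\<lambda>e. D (e 0) (e 1))"
    and D: "\<And>n. n \<^bold>\<in> w \<Longrightarrow> open_dense M le (D n)"
  shows "open_dense M le (\<lambda>x. \<forall>n. n \<^bold>\<in> w \<longrightarrow> D n x)"
  unfolding open_dense_def
proof (intro conjI allI impI)
  have up: "D n y" if "n \<^bold>\<in> w" "D n x" "related E le x y" for n x y
    using D[OF that(1)] that(2,3) unfolding open_dense_def by blast
  note def_intros = definable_intros definable_subst2[OF def_D]
  {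
    fix x y n
    assume "(\<forall>n. n \<^bold>\<in> w \<longrightarrow> D n x) \<and> related E le x y" "n \<^bold>\<in> w"
    then show "D n y" using up by blast
  next
    fix u assume u: "u \<^bold>\<in> M"
    define first where "first x n \<longleftrightarrow> n \<^bold>\<in> w \<and> \<not> D n x \<and> (\<forall>m. m \<^bold>\<in> n \<longrightarrow> D m x)" for x n
    have "\<exists>R. \<forall>p. p \<^bold>\<in> R \<longleftrightarrow> p \<^bold>\<in> le \<and>
        (\<exists>x y. is_pair E x y p \<and> (\<forall>n. first x n \<longrightarrow> D n y))"
      unfolding first_def by (rule separation) (intro def_intros)
    then obtain R where R: "\<And>p. p \<^bold>\<in> R \<longleftrightarrow> p \<^bold>\<in> le \<and>
        (\<exists>x y. is_pair E x y p \<and> (\<forall>n. first x n \<longrightarrow> D n y))"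
      by blast
    have R_iff: "related E R x y \<longleftrightarrow> related E le x y \<and> (\<forall>n. first x n \<longrightarrow> D n y)" for x y
      unfolding related_def R using is_pair_inject by metis
    have first_unique: "n = m" if "first x n" "first x m" for x n m
      using that omega_linear[OF w, of n m] unfolding first_def by blast
    have total: "\<exists>y. related E R x y" if x: "x \<^bold>\<in> M" for x
    proof (cases "\<exists>n. first x n")
      case True
      then obtain n where n: "first x n" by blast
      then obtain y where "related E le x y" "D n y"
        using D[of n] x unfolding first_def open_dense_def by blast
      then have "related E R x y" unfolding R_iff using first_unique[OF _ n] by blast
      then show ?thesis by blast
    next
      case False
      then have "related E R x x" unfolding R_iff using quasi_order_refl[OF le x] by blast
      then show ?thesis by blast
    qed
    have rel: "relation_on E M R"
      using le R unfolding quasi_order_def relation_on_def by blast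
    obtain w' f where w': "is_omega E w'" and f: "function_to E w' M f"
      and f0: "\<exists>z. is_empty E z \<and> related E f z u"
      and fs: "\<And>n. n \<^bold>\<in> w' \<Longrightarrow>
        \<exists>s x y. is_succ E n s \<and> related E f n x \<and> related E f s y \<and> related E R x y"
    proof -
      have "\<forall>x. x \<^bold>\<in> M \<longrightarrow> (\<exists>y. y \<^bold>\<in> M \<and> related E R x y)"
        using total relation_on_related[OF rel] by blast
      with DC[unfolded DC_def, rule_format, of M R u] u rel show ?thesis
        using that by blast
    qed
    have "w' = w" using is_omega_unique[OF w' w] .
    note f = f[unfolded this] and fs = fs[unfolded this]
    have fn: "function_on E w f" and fM: "\<And>n x. related E f n x \<Longrightarrow> x \<^bold>\<in> M"
      using f unfolding function_to_def by blast+
    have step: "related E R x y"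
      if "is_succ E n s" "related E f n x" "related E f s y" for n s x y
      using fs[OF function_on_domain[OF fn that(2)]] that is_succ_unique function_on_unique[OF fn]
      by metis
    \<comment> \<open>In the induction step, if \<open>D n\<close> does not hold yet at the \<open>n\<close>-th point, then \<open>n\<close> is its
      first missing index, and \<open>R\<close> forces \<open>D n\<close> at the next point.\<close>
    have passed: "\<forall>x m. related E f n x \<and> m \<^bold>\<in> n \<longrightarrow> D m x" if "n \<^bold>\<in> w" for n
      using w that
    proof (induct rule: omega_induct)
      case definable show ?case by (intro def_intros)
    next
      case zero then show ?case by (simp add: is_empty_def)
    next
      case (succ n s)
      obtain x where x: "related E f n x" using function_on_value[OF fn succ(1)] by blast
      have below: "D m x" if "m \<^bold>\<in> n" for m using succ(2) x that by blast
      show ?case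
      proof (intro allI impI, elim conjE)
        fix y m assume y: "related E f s y" and m: "m \<^bold>\<in> s"
        have xy: "related E le x y" "\<And>n. first x n \<Longrightarrow> D n y"
          using step[OF succ(3) x y] unfolding R_iff by blast+
        have mn: "m \<^bold>\<in> n \<or> m = n" using m is_succ_mem[OF succ(3)] by blast
        then have "m \<^bold>\<in> w" using succ(1) omega_transitive[OF w] by blast
        show "D m y"
        proof (cases "D m x")
          case True then show ?thesis using up[OF \<open>m \<^bold>\<in> w\<close> _ xy(1)] by blast
        next
          case False
          then have "m = n" using mn below by blast
          then have "first x m" using False succ(1) below unfolding first_def by blast
          then show ?thesis by (rule xy(2))
        qed
      qed
    qed
    have "ascending E le f"
      using ascending_if_steps[OF le w f] step R_iff by blast
    then obtain v where v: "\<And>n x. related E f n x \<Longrightarrow> related E le x v"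
      using ind w f unfolding sequentially_inductive_def by blast
    have "D n v" if n: "n \<^bold>\<in> w" for n
    proof -
      obtain s where s: "is_succ E n s" "s \<^bold>\<in> w" using omega_succ[OF w n] .
      obtain x where x: "related E f s x" using function_on_value[OF fn s(2)] .
      have "D n x" using passed[OF s(2)] x is_succ_mem[OF s(1)] by blast
      then show ?thesis using up[OF n] v[OF x] by blast
    qed
    moreover have "related E le u v" using f0 v by blast
    ultimately show "\<exists>v. related E le u v \<and> (\<forall>n. n \<^bold>\<in> w \<longrightarrow> D n v)" by blast
  }
qed

text \<open>
  The form in which objects named by at most one value enter the nesting: a triple of natural numbers
  is coded by at most one nested pair, and \<open>\<Phi>\<close> has at most one value at an index.
\<close>

lemma open_dense_the:
  assumes le: "quasi_order E M le"
    and unique: "\<And>q q'. T q \<Longrightarrow> T q' \<Longrightarrow> q = q'"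
    and D: "\<And>q. T q \<Longrightarrow> open_dense M le (D q)"
  shows "open_dense M le (\<lambda>x. \<forall>q. T q \<longrightarrow> D q x)"
proof (cases "\<exists>q. T q")
  case True
  then obtain q where q: "T q" by blast
  then have "(\<lambda>x. \<forall>q. T q \<longrightarrow> D q x) = D q" using unique by blast
  then show ?thesis using D[OF q] by simp
next
  case False
  then show ?thesis using quasi_order_refl[OF le] unfolding open_dense_def by blast
qed

section \<open>Settled rational numbers and maximal points\<close>

definition settled :: "'a \<Rightarrow> 'a \<Rightarrow> 'a \<Rightarrow> 'a \<Rightarrow> bool" where
  "settled le \<phi> q x \<longleftrightarrow>
     (\<forall>y s t. related E le x y \<and> related E \<phi> x s \<and> related E \<phi> y t \<and> q \<^bold>\<in> s \<longrightarrow> q \<^bold>\<in> t)"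

text \<open>
  Cofinality is the dichotomy: either \<open>q\<close> is missing from the value at some point above \<open>x\<close>, and
  that point settles \<open>q\<close> vacuously, or it is present everywhere above \<open>x\<close>.  Upward closure
  uses that a member of the value at a point is a member of the values below it.
\<close>

lemma open_dense_settled:
  assumes le: "quasi_order E M le" and \<phi>: "function_on E M \<phi>" and dec: "decreasing E le \<phi>"
  shows "open_dense M le (settled le \<phi> q)"
  unfolding open_dense_def
proof (intro conjI allI impI)
  fix x y assume "settled le \<phi> q x \<and> related E le x y"
  then have x: "settled le \<phi> q x" and xy: "related E le x y" by blast+
  show "settled le \<phi> q y"
    unfolding settled_def
  proof (intro allI impI, elim conjE)
    fix z s t
    assume yz: "related E le y z" and s: "related E \<phi> y s" and t: "related E \<phi> z t"
      and q: "q \<^bold>\<in> s"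
    obtain r where r: "related E \<phi> x r"
      using function_on_value[OF \<phi>] quasi_order_field[OF le xy] by blast
    have "q \<^bold>\<in> r"
      using dec xy r s q unfolding decreasing_def ereal_le_def is_subset_def by blast
    then show "q \<^bold>\<in> t"
      using x quasi_order_trans[OF le xy yz] r t unfolding settled_def by blast
  qed
next
  fix x assume x: "x \<^bold>\<in> M"
  show "\<exists>y. related E le x y \<and> settled le \<phi> q y"
  proof (cases "\<exists>y t. related E le x y \<and> related E \<phi> y t \<and> \<not> q \<^bold>\<in> t")
    case True
    then obtain y t where y: "related E le x y" "related E \<phi> y t" "\<not> q \<^bold>\<in> t" by blast
    then have "settled le \<phi> q y"
      unfolding settled_def using function_on_unique[OF \<phi>] by metis
    then show ?thesis using y(1) by blast
  next
    case False
    then have "settled le \<phi> q x" unfolding settled_def by blast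
    then show ?thesis using quasi_order_refl[OF le x] by blast
  qed
qed

text \<open>
  The code of the fraction \<open>(a - b) / c\<close>.
\<close>

definition is_triple :: "'a \<Rightarrow> 'a \<Rightarrow> 'a \<Rightarrow> 'a \<Rightarrow> bool" where
  "is_triple a b c q \<longleftrightarrow> (\<exists>d. is_pair E a b d \<and> is_pair E d c q)"

lemma open_dense_settled_all:
  assumes DC: "DC E" and le: "quasi_order E M le" and ind: "sequentially_inductive E M le"
    and w: "is_omega E w" and \<Phi>: "function_on E w \<Phi>"
    and dec: "\<forall>i \<phi>. related E \<Phi> i \<phi> \<longrightarrow> function_on E M \<phi> \<and> decreasing E le \<phi>"
  shows "open_dense M le (\<lambda>x. \<forall>i. i \<^bold>\<in> w \<longrightarrow> (\<forall>\<phi>. related E \<Phi> i \<phi> \<longrightarrow>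
    (\<forall>a. a \<^bold>\<in> w \<longrightarrow> (\<forall>b. b \<^bold>\<in> w \<longrightarrow> (\<forall>c. c \<^bold>\<in> w \<longrightarrow>
      (\<forall>q. is_triple a b c q \<longrightarrow> settled le \<phi> q x))))))"
proof (intro open_dense_INT[OF DC le ind w] open_dense_the[OF le])
  show "q = q'" if "is_triple a b c q" "is_triple a b c q'" for a b c q q'
    using that is_pair_unique unfolding is_triple_def by metis
  show "\<phi> = \<phi>'" if "related E \<Phi> i \<phi>" "related E \<Phi> i \<phi>'" for i \<phi> \<phi>'
    using that function_on_unique[OF \<Phi>] by blast
  show "open_dense M le (settled le \<phi> q)" if "related E \<Phi> i \<phi>" for i \<phi> q
    using open_dense_settled[OF le] dec that by blast
qed (unfold is_triple_def settled_def, (intro definable_intros)+)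

text \<open>
  Every member of an extended real is coded by a triple of natural numbers, so when all such
  triples are settled at \<open>v\<close>, no value loses a member above \<open>v\<close>; as \<open>\<phi>\<close> is decreasing, no value
  gains one either.
\<close>

lemma max_point_if_settled:
  assumes w: "is_omega E w" and \<Phi>: "function_on E w \<Phi>" and v: "v \<^bold>\<in> M"
    and \<phi>: "\<forall>i \<phi>. related E \<Phi> i \<phi> \<longrightarrow> ereal_function E M \<phi> \<and> decreasing E le \<phi>"
    and settled: "\<And>i \<phi> a b c q. \<lbrakk>i \<^bold>\<in> w; related E \<Phi> i \<phi>; a \<^bold>\<in> w; b \<^bold>\<in> w; c \<^bold>\<in> w; is_triple a b c q\<rbrakk>
      \<Longrightarrow> settled le \<phi> q v"
  shows "max_point E M le \<Phi> v"
  unfolding max_point_def maximal_point_def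
proof (intro conjI allI impI v, elim conjE)
  fix i \<phi> x assume i: "related E \<Phi> i \<phi>" and x: "x \<^bold>\<in> M" and vx: "related E le v x"
  have fn: "function_on E M \<phi>" and er: "\<And>x y. related E \<phi> x y \<Longrightarrow> is_ereal E y"
    and dec: "decreasing E le \<phi>"
    using \<phi> i unfolding ereal_function_def by blast+
  obtain s where s: "related E \<phi> v s" using function_on_value[OF fn v] .
  obtain t where t: "related E \<phi> x t" using function_on_value[OF fn x] .
  have "q \<^bold>\<in> s \<longleftrightarrow> q \<^bold>\<in> t" for q
  proof
    assume q: "q \<^bold>\<in> s"
    then have "is_rat E q" using er[OF s] unfolding is_ereal_def by blast
    then obtain a b c where "a \<^bold>\<in> w" "b \<^bold>\<in> w" "c \<^bold>\<in> w" "is_triple a b c q"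
      using is_nat_mem_omega[OF w] unfolding is_rat_def is_fraction_def is_triple_def by blast
    then have "settled le \<phi> q v"
      using settled function_on_domain[OF \<Phi> i] i by blast
    then show "q \<^bold>\<in> t" unfolding settled_def using vx s t q by blast
  next
    assume "q \<^bold>\<in> t"
    then show "q \<^bold>\<in> s"
      using dec vx s t unfolding decreasing_def ereal_le_def is_subset_def by blast
  qed
  then have "s = t" by (rule extensionality)
  then show "\<exists>y. related E \<phi> v y \<and> related E \<phi> x y" using s t by blast
qed

lemma max_point_invariant:
  assumes le: "quasi_order E M le"
    and \<phi>: "\<And>i \<phi>. related E \<Phi> i \<phi> \<Longrightarrow> function_on E M \<phi>"
    and u: "max_point E M le \<Phi> u" and uv: "related E le u v"
  shows "max_point E M le \<Phi> v"
  unfolding max_point_def maximal_point_def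
proof (intro conjI allI impI)
  show v: "v \<^bold>\<in> M" and "v \<^bold>\<in> M" using quasi_order_field[OF le uv] by blast+
  fix i \<phi> x assume i: "related E \<Phi> i \<phi>" and "x \<^bold>\<in> M \<and> related E le v x"
  then have x: "x \<^bold>\<in> M" "related E le u x" using quasi_order_trans[OF le uv] by blast+
  obtain y where "related E \<phi> u y" "related E \<phi> v y"
    using u i v uv unfolding max_point_def maximal_point_def by blast
  moreover obtain y' where "related E \<phi> u y'" "related E \<phi> x y'"
    using u i x unfolding max_point_def maximal_point_def by blast
  ultimately show "\<exists>y. related E \<phi> v y \<and> related E \<phi> x y"
    using function_on_unique[OF \<phi>[OF i]] by blast
qed

end

section \<open>The gauge ordering principles\<close>

theorem proposition7:
  fixes E :: "'a \<Rightarrow> 'a \<Rightarrow> bool" and j :: range_class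
  assumes "ZF_model E" and "DC E"
  shows "BBg E j"
proof -
  interpret zf_model E by unfold_locales (rule assms(1))
  show ?thesis
    unfolding BBg_def
  proof (intro allI impI, elim conjE)
    fix M le w \<Phi>
    assume le: "quasi_order E M le" and ind: "sequentially_inductive E M le"
      and w: "is_omega E w" and \<Phi>: "function_on E w \<Phi>"
      and all: "\<forall>i \<phi>. related E \<Phi> i \<phi> \<longrightarrow>
        ereal_function E M \<phi> \<and> decreasing E le \<phi> \<and> in_range_class E j \<phi>"
    have \<phi>: "\<forall>i \<phi>. related E \<Phi> i \<phi> \<longrightarrow> ereal_function E M \<phi> \<and> decreasing E le \<phi>"
      using all by blast
    then have fn: "\<forall>i \<phi>. related E \<Phi> i \<phi> \<longrightarrow> function_on E M \<phi> \<and> decreasing E le \<phi>"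
      unfolding ereal_function_def by blast
    have cofinal: "\<exists>v. max_point E M le \<Phi> v \<and> related E le u v" if u: "E u M" for u
    proof -
      obtain v where uv: "related E le u v" and v: "\<forall>i. E i w \<longrightarrow> (\<forall>\<phi>. related E \<Phi> i \<phi> \<longrightarrow>
          (\<forall>a. E a w \<longrightarrow> (\<forall>b. E b w \<longrightarrow> (\<forall>c. E c w \<longrightarrow>
            (\<forall>q. is_triple a b c q \<longrightarrow> settled le \<phi> q v)))))"
        using open_dense_cofinal[OF open_dense_settled_all[OF assms(2) le ind w \<Phi> fn] u]
        by blast
      have "max_point E M le \<Phi> v"
        using max_point_if_settled[OF w \<Phi> _ \<phi>] quasi_order_field[OF le uv] v by blast
      then show ?thesis using uv by blast
    qed
    show "(\<forall>u. E u M \<longrightarrow> (\<exists>v. max_point E M le \<Phi> v \<and> related E le u v)) \<and>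
      (\<forall>u v. max_point E M le \<Phi> u \<and> E v M \<and> related E le u v \<longrightarrow> max_point E M le \<Phi> v)"
      using cofinal max_point_invariant[OF le] fn by blast
  qed
qed

end
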